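(* An FSA $\mathcal{S}$ is not strongly periodically detectable if and only if in its $\varepsilon$-extended self-composition $\mathrm{CC_A^{\leftarrow_\epsilon}}(\mathcal{S})$ at least one of the two following conditions holds. (i) There is a reachable state $(x,\bar x)$ of $\mathrm{CC_A^{\leftarrow_\epsilon}}(\mathcal{S})$ such that $x\neq\bar x$ and there is a transition sequence $x\xrightarrow{s_1}x'\xrightarrow{s_2}x'$ in $\mathcal{S}$ for some $s_1\in(T_{uo})^*$, $s_2\in(T_{uo})^+$, $x'\in X$. (ii) There is a reachable transition cycle $(x_1,\bar x_1)\xrightarrow{s_1'}\cdots\xrightarrow{s_n'}(x_{n+1},\bar x_{n+1})$ in $\mathrm{CC_A^{\leftarrow_\epsilon}}(\mathcal{S})$ for some positive integer $n$ such that $(x_1,\bar x_1)=(x_{n+1},\bar x_{n+1})$, $x_i\neq\bar x_i$, and $\ell(s_i')\in\Sigma$ for all $i\in\{1,\dots,n\}$.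
   Context: The symbol $\subset$ denotes the (not necessarily proper) subset relation. For a finite alphabet $A$, $A^*$ and $A^\omega$ denote the sets of finite words (including the empty word $\epsilon$) and of infinite sequences over $A$, and $A^+=A^*\setminus\{\epsilon\}$. For $s\in A^*\cup A^\omega$, $s'\sqsubset s$ means that $s'\in A^*$ is a (not necessarily proper) prefix of $s$. $|s|$ is the length of a word $s$; $|S|$ is the cardinality of a set $S$. A finite-state automaton (FSA) is a sextuple $\mathcal{S}=(X,T,X_0,\delta,\Sigma,\ell)$, where $X$ is a finite set of states, $T$ a finite set of events, $X_0\subset X$ a set of initial states, $\delta\subset X\times T\times X$ a transition relation, $\Sigma$ a finite set of outputs (labels), and $\ell:T\to\Sigma\cup\{\epsilon\}$ a labeling function, extended to $\ell:T^*\cup T^\omega\to\Sigma^*\cup\Sigma^\omega$ by $\ell(t_1t_2\dots)=\ell(t_1)\ell(t_2)\dots$, $\ell(\epsilon)=\epsilon$ (a sequence in $T^\omega$ may have a finite label sequence). $T_{uo}=\{t\in T:\ell(t)=\epsilon\}$ is the set of unobservable events. $\delta$ is extended to $\delta\subset X\times T^*\times X$ in the usual way; $x\xrightarrow{s}x'$ means $(x,s,x')\in\delta$. $L^\omega(\mathcal{S})=\{t_1t_2\dots\in T^\omega : \exists x_0\in X_0,\ \exists x_1,x_2,\dots\in X,\ x_0\xrightarrow{t_1}x_1\xrightarrow{t_2}\cdots\}$. For $\sigma\in\Sigma^*$, the current-state estimate is $\mathcal{M}(\mathcal{S},\sigma)=\{x\in X : \exists x_0\in X_0,\ \exists s\in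 T^*,\ \ell(s)=\sigma \text{ and } x_0\xrightarrow{s}x\}$. $\mathcal{S}$ is strongly periodically detectable if there exists a positive integer $k$ such that for each $s\in L^\omega(\mathcal{S})$ and each finite prefix $s'\sqsubset s$, there is $s''\in T^*$ such that $|\ell(s'')|<k$, $s's''\sqsubset s$, and $|\mathcal{M}(\mathcal{S},\ell(s's''))|=1$. Self-composition: $\mathrm{CC_A}(\mathcal{S})=(X',T',X_0',\delta')$, where $X'=X\times X$, $X_0'=X_0\times X_0$, $T'=T_o'\cup T_{uo}'$ with $T_o'=\{(t,t'):t,t'\in T,\ \ell(t)=\ell(t')\in\Sigma\}$ and $T_{uo}'=\{(t,\epsilon):t\in T,\ \ell(t)=\epsilon\}\cup\{(\epsilon,t):t\in T,\ \ell(t)=\epsilon\}$; for $(y_1,y_1'),(y_2,y_2')\in X'$: $((y_1,y_1'),(t,t'),(y_2,y_2'))\in\delta'$ iff $(y_1,t,y_2),(y_1',t',y_2')\in\delta$, for $(t,t')\in T_o'$; $((y_1,y_1'),(t,\epsilon),(y_2,y_2'))\in\delta'$ iff $(y_1,t,y_2)\in\delta$ and $y_1'=y_2'$; $((y_1,y_1'),(\epsilon,t),(y_2,y_2'))\in\delta'$ iff $y_1=y_2$ and $(y_1',t,y_2')\in\delta$. The label $\ell(t')$ of $t'\in T'$ is the common label in $\Sigma\cup\{\epsilon\}$ of its two components, and $\ell$ extends to sequences by concatenation. $\varepsilon$-extended self-composition: $\mathrm{CC_A^{\leftarrow_\epsilon}}(\mathcal{S})=(X',T'\cup\{\varepsilon\},X_0',\delta'_{\leftarrow_\epsilon})$,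 where $\varepsilon$ is an additional event with $\ell(\varepsilon)=\epsilon$, is obtained from $\mathrm{CC_A}(\mathcal{S})$ by adding transitions as follows: for all $y_1,y_2,y_3,y_4\in X$ and $t'\in T'$ such that $y_1\ne y_2$ and $((y_1,y_1),t',(y_3,y_4))\in\delta'$ (resp., $((y_2,y_2),t',(y_3,y_4))\in\delta'$), but $((y_1,y_2),\bar t',(y_3,y_4))\notin\delta'$ for any $\bar t'\in T'$, add the transition $((y_1,y_2),\varepsilon,(y_1,y_1))$ (resp., $((y_1,y_2),\varepsilon,(y_2,y_2))$). In an automaton, a state is reachable if it is initial or can be reached from an initial state by a transition sequence. A transition cycle is a transition sequence of positive length from a state to itself; it is reachable if its states are reachable. In condition (ii) each $s_i'\in(T'\cup\{\varepsilon\})^*$ is a finite event sequence. *)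

theory Defs
  imports Main "HOL-Library.Omega_Words_Fun"
begin

text \<open>
  The empty output \<open>\<epsilon>\<close> of the labeling function is represented by \<^const>\<open>None\<close>. The same record
  type serves for the self-composition and its extension below, whose labels again lie in
  \<open>\<Sigma> \<union> {\<epsilon>}\<close>.
\<close>

record ('x, 't, 'o) fsa =
  states :: "'x set"
  events :: "'t set"
  init :: "'x set"
  trans :: "('x \<times> 't \<times> 'x) set"
  outputs :: "'o set"
  label :: "'t \<Rightarrow> 'o option"

definition is_fsa :: "('x, 't, 'o) fsa \<Rightarrow> bool" where
  "is_fsa S \<longleftrightarrow>
     finite (states S) \<and> finite (events S) \<and> finite (outputs S) \<and>
     init S \<subseteq> states S \<and>
     trans S \<subseteq> states S \<times> events S \<times> states S \<and>
     (\<forall>t\<in>events S. label S t = None \<or> (\<exists>a\<in>outputs S. label S t = Some a))"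

definition word_label :: "('x, 't, 'o) fsa \<Rightarrow> 't list \<Rightarrow> 'o list" where
  "word_label S w = List.map_filter (label S) w"

definition unobs_events :: "('x, 't, 'o) fsa \<Rightarrow> 't set" where
  "unobs_events S = {t \<in> events S. label S t = None}"

text \<open>\<open>path S x w y\<close>: the triple \<open>(x, w, y)\<close> belongs to the extension of the transition relation to
  finite words.\<close>

fun path :: "('x, 't, 'o) fsa \<Rightarrow> 'x \<Rightarrow> 't list \<Rightarrow> 'x \<Rightarrow> bool" where
  "path S x [] y \<longleftrightarrow> x \<in> states S \<and> x = y"
| "path S x (t # w) y \<longleftrightarrow> (\<exists>z. (x, t, z) \<in> trans S \<and> path S z w y)"

definition reachable :: "('x, 't, 'o) fsa \<Rightarrow> 'x \<Rightarrow> bool" where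
  "reachable S x \<longleftrightarrow> (\<exists>x0\<in>init S. \<exists>s\<in>lists (events S). path S x0 s x)"

definition omega_lang :: "('x, 't, 'o) fsa \<Rightarrow> 't word set" where
  "omega_lang S = {s. (\<forall>i. s i \<in> events S) \<and>
     (\<exists>r. r 0 \<in> init S \<and> (\<forall>i. r i \<in> states S) \<and> (\<forall>i. (r i, s i, r (Suc i)) \<in> trans S))}"

definition is_prefix :: "'t list \<Rightarrow> 't word \<Rightarrow> bool" where
  "is_prefix u s \<longleftrightarrow> u = prefix (length u) s"

definition estimate :: "('x, 't, 'o) fsa \<Rightarrow> 'o list \<Rightarrow> 'x set" where
  "estimate S \<sigma> =
     {x \<in> states S. \<exists>x0\<in>init S. \<exists>s\<in>lists (events S). word_label S s = \<sigma> \<and> path S x0 s x}"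

definition strongly_periodically_detectable :: "('x, 't, 'o) fsa \<Rightarrow> bool" where
  "strongly_periodically_detectable S \<longleftrightarrow>
     (\<exists>k::nat. k > 0 \<and>
       (\<forall>s\<in>omega_lang S. \<forall>s'. is_prefix s' s \<longrightarrow>
         (\<exists>s''\<in>lists (events S). length (word_label S s'') < k \<and> is_prefix (s' @ s'') s \<and>
            card (estimate S (word_label S (s' @ s''))) = 1)))"

text \<open>
  Events of the self-composition are pairs over \<open>T \<union> {\<epsilon>}\<close>, with \<^const>\<open>None\<close> for \<open>\<epsilon>\<close>;
  \<open>(None, None)\<close> is not an event.
\<close>

definition cc_obs_events :: "('x, 't, 'o) fsa \<Rightarrow> ('t option \<times> 't option) set" where
  "cc_obs_events S =
     {(Some t, Some t') | t t'. t \<in> events S \<and> t' \<in> events S \<and>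
        label S t = label S t' \<and> label S t \<in> Some ` outputs S}"

definition cc_unobs_events :: "('x, 't, 'o) fsa \<Rightarrow> ('t option \<times> 't option) set" where
  "cc_unobs_events S =
     {(Some t, None) | t. t \<in> events S \<and> label S t = None} \<union>
     {(None, Some t) | t. t \<in> events S \<and> label S t = None}"

text \<open>Both components of an event of the self-composition have the same label, where the component
  \<open>\<epsilon>\<close> has label \<open>\<epsilon>\<close>; hence the first component determines the label.\<close>

fun cc_label :: "('x, 't, 'o) fsa \<Rightarrow> 't option \<times> 't option \<Rightarrow> 'o option" where
  "cc_label S (Some t, _) = label S t"
| "cc_label S (None, _) = None"

definition self_comp ::
  "('x, 't, 'o) fsa \<Rightarrow> ('x \<times> 'x, 't option \<times> 't option, 'o) fsa" where
  "self_comp S = \<lparr>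
     states = states S \<times> states S,
     events = cc_obs_events S \<union> cc_unobs_events S,
     init = init S \<times> init S,
     trans =
       {((y1, y1'), (Some t, Some t'), (y2, y2')) | y1 y1' t t' y2 y2'.
          (Some t, Some t') \<in> cc_obs_events S \<and>
          (y1, t, y2) \<in> trans S \<and> (y1', t', y2') \<in> trans S} \<union>
       {((y1, y1'), (Some t, None), (y2, y2')) | y1 y1' t y2 y2'.
          (Some t, None) \<in> cc_unobs_events S \<and>
          y1' \<in> states S \<and> (y1, t, y2) \<in> trans S \<and> y1' = y2'} \<union>
       {((y1, y1'), (None, Some t), (y2, y2')) | y1 y1' t y2 y2'.
          (None, Some t) \<in> cc_unobs_events S \<and>
          y1 \<in> states S \<and> y1 = y2 \<and> (y1', t, y2') \<in> trans S},
     outputs = outputs S,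
     label = cc_label S \<rparr>"

text \<open>In the extension, \<open>Some e\<close> is the event \<open>e\<close> of the self-composition and \<^const>\<open>None\<close> is the
  additional event \<open>\<epsilon>\<close>, whose label is empty.\<close>

definition eps_self_comp ::
  "('x, 't, 'o) fsa \<Rightarrow> ('x \<times> 'x, ('t option \<times> 't option) option, 'o) fsa" where
  "eps_self_comp S = (let C = self_comp S in \<lparr>
     states = states C,
     events = insert None (Some ` events C),
     init = init C,
     trans =
       {(y, Some e, z) | y e z. (y, e, z) \<in> trans C} \<union>
       {((y1, y2), None, (y1, y1)) | y1 y2.
          y1 \<in> states S \<and> y2 \<in> states S \<and> y1 \<noteq> y2 \<and>
          (\<exists>y3\<in>states S. \<exists>y4\<in>states S.
             (\<exists>e\<in>events C. ((y1, y1), e, (y3, y4)) \<in> trans C) \<and>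
             (\<forall>e\<in>events C. ((y1, y2), e, (y3, y4)) \<notin> trans C))} \<union>
       {((y1, y2), None, (y2, y2)) | y1 y2.
          y1 \<in> states S \<and> y2 \<in> states S \<and> y1 \<noteq> y2 \<and>
          (\<exists>y3\<in>states S. \<exists>y4\<in>states S.
             (\<exists>e\<in>events C. ((y2, y2), e, (y3, y4)) \<in> trans C) \<and>
             (\<forall>e\<in>events C. ((y1, y2), e, (y3, y4)) \<notin> trans C))},
     outputs = outputs C,
     label = (\<lambda>e. case e of None \<Rightarrow> None | Some e' \<Rightarrow> label C e') \<rparr>)"

end

theory Submission
  imports Defs
begin

text \<open>
  Two distinct states lie in a common estimate iff the pair of them is reachable in the
  (\<open>\<epsilon>\<close>-extended) self-composition, since an \<open>\<epsilon>\<close>-transition only forgets one component.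

  Suppose \<open>S\<close> is not strongly periodically detectable. If a non-detecting continuation eventually
  emits no further label, it runs into an unobservable cycle, which is (i). Otherwise there are
  arbitrarily long label words along which every estimate has two elements. Such a word is traced
  backwards from a pair \<open>(x, y)\<close> of its last estimate. If \<open>x\<close> and \<open>y\<close> are reached from distinct
  predecessors, these form the preceding pair. If both are reached from the same \<open>p\<close>, choose any
  other \<open>q\<close> in the same estimate: either \<open>(p, q)\<close> may collapse to \<open>(p, p)\<close>, or all successors of
  \<open>(p, p)\<close> are successors of \<open>(p, q)\<close>, and then \<open>(p, q)\<close> or \<open>(q, p)\<close> leads to \<open>(x, y)\<close> with a
  single label unless (i) or (ii) holds for some pair nearby. A chain longer than the
  number of pairs repeats a pair, which is (ii).

  Conversely, (i) yields at once a run with a constant ambiguous estimate. Given a cycle (ii) at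
  \<open>(x, y)\<close> with label word \<open>w\<close>, each of \<open>x\<close>, \<open>y\<close> is reached by \<open>w\<close> from one of \<open>x\<close>, \<open>y\<close>; hence \<open>S\<close> has
  a cycle through \<open>x\<close> or \<open>y\<close> labelled \<open>w\<close> or \<open>ww\<close>, and repeating it forever never passes a
  singleton estimate.
\<close>

section \<open>Labelled paths and estimates\<close>

text \<open>The one part of \<open>is_fsa\<close> on which the path lemmas rest. Isolating it lets
  them serve both \<open>S\<close> and its extended self-composition without a well-formedness proof
  for the latter.\<close>

definition closed_trans :: "('x, 't, 'o) fsa \<Rightarrow> bool" where
  "closed_trans A \<longleftrightarrow> trans A \<subseteq> states A \<times> events A \<times> states A"

text \<open>Event words are forgotten and only their labels kept: \<open>S\<close> and its
  self-composition have different event types, so label words are the language in which their paths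
  can be compared.\<close>

definition lpath :: "('x, 't, 'o) fsa \<Rightarrow> 'x \<Rightarrow> 'o list \<Rightarrow> 'x \<Rightarrow> bool" where
  "lpath A x w y \<longleftrightarrow> (\<exists>s\<in>lists (events A). path A x s y \<and> word_label A s = w)"

lemma word_label_Nil [simp]: "word_label A [] = []"
  by (simp add: word_label_def List.map_filter_def)

lemma word_label_Cons:
  "word_label A (t # s) = (case label A t of None \<Rightarrow> word_label A s | Some a \<Rightarrow> a # word_label A s)"
  by (simp add: word_label_def List.map_filter_def split: option.split)

lemma word_label_append [simp]: "word_label A (u @ v) = word_label A u @ word_label A v"
  by (induction u) (auto simp: word_label_Cons split: option.split)

lemma word_label_unobs:
  assumes "s \<in> lists (unobs_events A)"
  shows "word_label A s = []"
  using assms by (induction s) (auto simp: word_label_Cons unobs_events_def)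

lemma unobs_if_word_label_Nil:
  assumes "word_label A s = []" "s \<in> lists (events A)"
  shows "s \<in> lists (unobs_events A)"
  using assms
  by (induction s) (auto simp: word_label_Cons unobs_events_def split: option.splits)

text \<open>Each event contributes at most one letter, so no prefix length of the label word is
  skipped. This allows paths to be cut at a prescribed label.\<close>

lemma take_word_label:
  assumes "j \<le> length (word_label A s)"
  shows "\<exists>i\<le>length s. take j (word_label A s) = word_label A (take i s)"
  using assms
proof (induction s rule: rev_induct)
  case Nil
  then show ?case by simp
next
  case (snoc t s)
  show ?case
  proof (cases "j \<le> length (word_label A s)")
    case True
    then obtain i where "i \<le> length s" "take j (word_label A s) = word_label A (take i s)"
      using snoc.IH by auto
    with True show ?thesis by (intro exI[of _ i]) simp
  next
    case False
    with snoc.prems have "j = length (word_label A (s @ [t]))"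
      by (auto simp: word_label_Cons split: option.splits)
    then show ?thesis by (intro exI[of _ "length (s @ [t])"]) simp
  qed
qed

lemma path_append: "path A x u y \<Longrightarrow> path A y v z \<Longrightarrow> path A x (u @ v) z"
  by (induction u arbitrary: x) auto

lemma path_states:
  assumes "closed_trans A" "path A x s y"
  shows "x \<in> states A" "y \<in> states A"
proof -
  from assms have "x \<in> states A \<and> y \<in> states A"
    by (induction s arbitrary: x) (auto simp: closed_trans_def)
  then show "x \<in> states A" "y \<in> states A" by auto
qed

lemma path_events:
  assumes "closed_trans A" "path A x s y"
  shows "s \<in> lists (events A)"
  using assms by (induction s arbitrary: x) (auto simp: closed_trans_def)

lemma path_appendE:
  assumes "closed_trans A" "path A x (u @ v) z"
  obtains y where "path A x u y" "path A y v z"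
proof -
  from assms(2) have "\<exists>y. path A x u y \<and> path A y v z"
  proof (induction u arbitrary: x)
    case Nil
    then show ?case using path_states(1)[OF assms(1)] by auto
  next
    case (Cons t u)
    then obtain x' where "(x, t, x') \<in> trans A" "path A x' (u @ v) z" by auto
    with Cons.IH show ?case by fastforce
  qed
  then show thesis using that by blast
qed

text \<open>Gives access to the intermediate states by index, as required for gluing finite paths
  into an infinite run.\<close>

lemma path_iff_states_fun:
  assumes "closed_trans A"
  shows "path A x s y \<longleftrightarrow>
    x \<in> states A \<and> (\<exists>f. f 0 = x \<and> f (length s) = y \<and> (\<forall>i<length s. (f i, s ! i, f (Suc i)) \<in> trans A))"
proof (induction s arbitrary: x)
  case Nil
  then show ?case by (auto intro: exI[of _ "\<lambda>_. x"])
next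
  case (Cons t s)
  show ?case
  proof
    assume "path A x (t # s) y"
    then obtain z where z: "(x, t, z) \<in> trans A" "path A z s y" by auto
    then obtain f where f: "f 0 = z" "f (length s) = y"
      "\<forall>i<length s. (f i, s ! i, f (Suc i)) \<in> trans A"
      using Cons.IH by auto
    have "(case_nat x f i, (t # s) ! i, case_nat x f (Suc i)) \<in> trans A" if "i < length (t # s)" for i
      using that f z by (cases i) auto
    then have "\<exists>g. g 0 = x \<and> g (length (t # s)) = y \<and>
        (\<forall>i<length (t # s). (g i, (t # s) ! i, g (Suc i)) \<in> trans A)"
      using f(2) by (intro exI[of _ "case_nat x f"]) simp
    then show "x \<in> states A \<and> (\<exists>g. g 0 = x \<and> g (length (t # s)) = y \<and>
        (\<forall>i<length (t # s). (g i, (t # s) ! i, g (Suc i)) \<in> trans A))"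
      using z(1) assms by (auto simp: closed_trans_def)
  next
    assume "x \<in> states A \<and> (\<exists>g. g 0 = x \<and> g (length (t # s)) = y \<and>
        (\<forall>i<length (t # s). (g i, (t # s) ! i, g (Suc i)) \<in> trans A))"
    then obtain g where g: "g 0 = x" "g (length (t # s)) = y"
      "\<forall>i<length (t # s). (g i, (t # s) ! i, g (Suc i)) \<in> trans A" by blast
    have 1: "(x, t, g (Suc 0)) \<in> trans A" using g(1) g(3)[rule_format, of 0] by simp
    moreover have "path A (g (Suc 0)) s y"
      unfolding Cons.IH
    proof (intro conjI exI[of _ "\<lambda>i. g (Suc i)"] allI impI)
      show "g (Suc 0) \<in> states A" using 1 assms by (auto simp: closed_trans_def)
      show "(g (Suc i), s ! i, g (Suc (Suc i))) \<in> trans A" if "i < length s" for i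
        using that g(3)[rule_format, of "Suc i"] by simp
    qed (use g(2) in simp_all)
    ultimately show "path A x (t # s) y" by auto
  qed
qed

lemma lpathI: "closed_trans A \<Longrightarrow> path A x s y \<Longrightarrow> lpath A x (word_label A s) y"
  using path_events[of A x s y] by (auto simp: lpath_def)

lemma lpath_refl: "x \<in> states A \<Longrightarrow> lpath A x [] x"
  unfolding lpath_def by (intro bexI[of _ "[]"]) auto

lemma lpath_unobs:
  assumes "closed_trans A" "(x, t, y) \<in> trans A" "label A t = None"
  shows "lpath A x [] y"
  using lpathI[of A x "[t]" y] assms by (auto simp: word_label_Cons closed_trans_def)

lemma lpath_obs:
  assumes "closed_trans A" "(x, t, y) \<in> trans A" "label A t = Some a"
  shows "lpath A x [a] y"
  using lpathI[of A x "[t]" y] assms by (auto simp: word_label_Cons closed_trans_def)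

lemma lpath_append:
  assumes "lpath A x u y" "lpath A y v z"
  shows "lpath A x (u @ v) z"
proof -
  obtain s s' where "s \<in> lists (events A)" "path A x s y" "word_label A s = u"
    "s' \<in> lists (events A)" "path A y s' z" "word_label A s' = v"
    using assms unfolding lpath_def by blast
  then show ?thesis
    unfolding lpath_def by (intro bexI[of _ "s @ s'"]) (auto intro: path_append)
qed

lemmas lpath_Nil_append = lpath_append[where u = "[]", simplified]
lemmas lpath_append_Nil = lpath_append[where v = "[]", simplified]

lemma lpath_states:
  assumes "closed_trans A" "lpath A x w y"
  shows "x \<in> states A" "y \<in> states A"
  using assms(2) path_states[OF assms(1)] unfolding lpath_def by blast+

text \<open>The event word is cut where its label has just become \<open>u\<close>; such a position
  exists by \<open>take_word_label\<close>.\<close>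

lemma lpath_appendE:
  assumes "closed_trans A" "lpath A x (u @ v) z"
  obtains y where "lpath A x u y" "lpath A y v z"
proof -
  obtain s where s: "path A x s z" "word_label A s = u @ v"
    using assms(2) unfolding lpath_def by blast
  obtain i where i: "take (length u) (word_label A s) = word_label A (take i s)"
    using take_word_label[of "length u" A s] s(2) by auto
  have u: "word_label A (take i s) = u" using i s(2) by simp
  then have v: "word_label A (drop i s) = v"
    using s(2) word_label_append[of A "take i s" "drop i s"] by simp
  obtain y where "path A x (take i s) y" "path A y (drop i s) z"
    using path_appendE[of A x "take i s" "drop i s" z] assms(1) s(1) by auto
  then show thesis using that lpathI[OF assms(1)] u v by metis
qed

lemma lpath_ConsE:
  assumes "closed_trans A" "lpath A x (a # w) z"
  obtains y t y' where "lpath A x [] y" "(y, t, y') \<in> trans A" "label A t = Some a" "lpath A y' w z"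
proof -
  obtain s where "path A x s z" "word_label A s = a # w"
    using assms(2) unfolding lpath_def by blast
  then have "\<exists>y t y'. lpath A x [] y \<and> (y, t, y') \<in> trans A \<and> label A t = Some a \<and> lpath A y' w z"
  proof (induction s arbitrary: x)
    case Nil
    then show ?case by simp
  next
    case (Cons t s)
    then obtain x' where x': "(x, t, x') \<in> trans A" "path A x' s z" by auto
    show ?case
    proof (cases "label A t")
      case None
      then have "lpath A x [] x'" using x' assms(1) lpath_unobs by metis
      moreover have "word_label A s = a # w" using Cons.prems None by (simp add: word_label_Cons)
      ultimately show ?thesis using Cons.IH[OF x'(2)] lpath_append[of A x "[]" x' "[]"] by fastforce
    next
      case (Some b)
      then have "b = a" "word_label A s = w" using Cons.prems by (auto simp: word_label_Cons)
      moreover have "x \<in> states A" using x'(1) assms(1) by (auto simp: closed_trans_def)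
      ultimately show ?thesis using Some x' lpathI[OF assms(1) x'(2)] lpath_refl by metis
    qed
  qed
  then show thesis using that by blast
qed

lemma lpath_single_cases:
  assumes "closed_trans A" "lpath A x [a] z"
  obtains (unobs) t y where "(x, t, y) \<in> trans A" "label A t = None" "lpath A y [a] z"
  | (obs) t y where "(x, t, y) \<in> trans A" "label A t = Some a" "lpath A y [] z"
proof -
  obtain s where s: "path A x s z" "word_label A s = [a]"
    using assms(2) unfolding lpath_def by blast
  then obtain t s' y where "s = t # s'" "(x, t, y) \<in> trans A" "path A y s' z"
    by (cases s) auto
  moreover from this have "lpath A y (word_label A s') z" using lpathI[OF assms(1)] by blast
  ultimately show thesis using s(2) unobs obs
    by (auto simp: word_label_Cons split: option.splits)
qed

lemma reachable_iff_lpath: "reachable A x \<longleftrightarrow> (\<exists>x0\<in>init A. \<exists>w. lpath A x0 w x)"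
  unfolding reachable_def lpath_def by blast

lemma reachable_lpath: "reachable A x \<Longrightarrow> lpath A x w y \<Longrightarrow> reachable A y"
  unfolding reachable_iff_lpath using lpath_append by metis

lemma estimate_iff_lpath:
  assumes "closed_trans A"
  shows "x \<in> estimate A w \<longleftrightarrow> (\<exists>x0\<in>init A. lpath A x0 w x)"
  using path_states(2)[OF assms] unfolding estimate_def lpath_def by auto

lemma estimate_append:
  assumes "closed_trans A" "x \<in> estimate A u" "lpath A x v y"
  shows "y \<in> estimate A (u @ v)"
  using assms(2,3) lpath_append unfolding estimate_iff_lpath[OF assms(1)] by metis

lemma estimate_unobs:
  assumes "closed_trans A" "x \<in> estimate A u" "lpath A x [] y"
  shows "y \<in> estimate A u"
  using estimate_append[OF assms] by simp

lemma estimate_appendE: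
  assumes "closed_trans A" "y \<in> estimate A (u @ v)"
  obtains x where "x \<in> estimate A u" "lpath A x v y"
  using assms(2) lpath_appendE[OF assms(1)] unfolding estimate_iff_lpath[OF assms(1)] by metis

section \<open>Ultimately periodic runs\<close>

lemma lasso_in_omega_lang:
  assumes closed: "closed_trans A" and init: "x \<in> init A"
    and u: "path A x u y" and v: "path A y v y" "v \<noteq> []"
  shows "u \<frown> v\<^sup>\<omega> \<in> omega_lang A"
proof -
  obtain f where f: "f 0 = x" "f (length u) = y" "\<forall>i<length u. (f i, u ! i, f (Suc i)) \<in> trans A"
    using u unfolding path_iff_states_fun[OF closed] by blast
  obtain g where g: "g 0 = y" "g (length v) = y" "\<forall>i<length v. (g i, v ! i, g (Suc i)) \<in> trans A"
    using v(1) unfolding path_iff_states_fun[OF closed] by blast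
  \<comment> \<open>From position \<open>length u\<close> on, the states of the cycle are repeated;
    the switch is consistent because \<open>f (length u)\<close> and \<open>g 0\<close> are both
    \<open>y\<close>.\<close>
  define r where "r i = (if i < length u then f i else g ((i - length u) mod length v))" for i
  have tr: "(r i, (u \<frown> v\<^sup>\<omega>) i, r (Suc i)) \<in> trans A" for i
  proof (cases "i < length u")
    case True
    have "r (Suc i) = f (Suc i)"
    proof (cases "Suc i = length u")
      case True
      then show ?thesis using f(2) g(1) by (simp add: r_def)
    next
      case False
      then show ?thesis using \<open>i < length u\<close> by (simp add: r_def)
    qed
    then show ?thesis using True f(3) by (simp add: r_def conc_def)
  next
    case False
    define j where "j = (i - length u) mod length v"
    have j: "j < length v" using v(2) by (simp add: j_def)
    have "Suc i - length u = Suc (i - length u)" using False by simp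
    \<comment> \<open>At the end of a round the index wraps to 0, which is harmless since
      \<open>g (length v) = g 0\<close>.\<close>
    then have "(Suc i - length u) mod length v = (if Suc j = length v then 0 else Suc j)"
      unfolding j_def by (simp add: mod_Suc)
    then have "r (Suc i) = g (Suc j)" using False g(1,2) by (auto simp: r_def)
    moreover have "(u \<frown> v\<^sup>\<omega>) i = v ! j" using False v(2) by (simp add: conc_def iter_def j_def)
    moreover have "r i = g j" using False by (simp add: r_def j_def)
    ultimately show ?thesis using g(3) j by simp
  qed
  moreover have "r 0 \<in> init A" using f g(1) init by (auto simp: r_def)
  ultimately show ?thesis using closed unfolding omega_lang_def closed_trans_def by blast
qed

lemma prefix_iter_concat:
  assumes "v \<noteq> []"
  shows "prefix (N * length v) (v\<^sup>\<omega>) = concat (replicate N v)"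
proof (induction N)
  case 0
  then show ?case by simp
next
  case (Suc N)
  have "prefix (Suc N * length v) (v\<^sup>\<omega>) = prefix (Suc N * length v) (v \<frown> v\<^sup>\<omega>)"
    using iter_unroll[of v] assms by simp
  then show ?case using Suc by simp
qed

text \<open>Reduces prefixes of the infinite run to prefixes of finite powers of \<open>v\<close>.
  As \<open>v\<close> is nonempty, \<open>length s\<close> copies are long enough to cover
  \<open>s\<close>.\<close>

lemma is_prefix_lasso:
  assumes "is_prefix (u @ s) (u \<frown> v\<^sup>\<omega>)" "v \<noteq> []"
  obtains s' where "s @ s' = concat (replicate (length s) v)"
proof -
  have "u @ s = u @ prefix (length s) (v\<^sup>\<omega>)"
    using assms(1) unfolding is_prefix_def by simp
  then have s: "s = prefix (length s) (v\<^sup>\<omega>)" by simp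
  have "length s \<le> length s * length v" using assms(2) by (cases v) auto
  then have "prefix (length s * length v) (v\<^sup>\<omega>) =
      prefix (length s) (v\<^sup>\<omega>) @ subsequence (v\<^sup>\<omega>) (length s) (length s * length v)"
    by (metis subsequence_append le_add_diff_inverse)
  then show thesis using that s prefix_iter_concat[OF assms(2)] by metis
qed

section \<open>The extended self-composition\<close>

locale finite_fsa =
  fixes S :: "('x, 't, 'o) fsa"
  assumes is_fsa: "is_fsa S"
begin

abbreviation E :: "('x \<times> 'x, ('t option \<times> 't option) option, 'o) fsa" where
  "E \<equiv> eps_self_comp S"

text \<open>The event is left arbitrary, its label included, because the condition that adds or
  suppresses an \<open>\<epsilon>\<close>-transition ignores labels too.\<close>

definition cc_step :: "'x \<times> 'x \<Rightarrow> 'x \<times> 'x \<Rightarrow> bool" where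
  "cc_step P Q \<longleftrightarrow> (\<exists>e. (P, e, Q) \<in> trans (self_comp S))"

lemma closed: "closed_trans S"
  using is_fsa by (simp add: is_fsa_def closed_trans_def)

lemma trans_states: "(x, t, y) \<in> trans S \<Longrightarrow> x \<in> states S \<and> t \<in> events S \<and> y \<in> states S"
  using closed by (auto simp: closed_trans_def)

lemma label_output: "t \<in> events S \<Longrightarrow> label S t = Some a \<Longrightarrow> a \<in> outputs S"
  using is_fsa by (fastforce simp: is_fsa_def)

lemma states_E: "states E = states S \<times> states S"
  and events_E: "events E = insert None (Some ` events (self_comp S))"
  and init_E: "init E = init S \<times> init S"
  and label_E: "label E None = None" "label E (Some e) = cc_label S e"
  by (simp_all add: eps_self_comp_def self_comp_def)

lemma closed_self_comp: "closed_trans (self_comp S)"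
  unfolding closed_trans_def self_comp_def by (auto dest: trans_states)

lemma states_self_comp: "states (self_comp S) = states S \<times> states S"
  by (simp add: self_comp_def)

lemma trans_E_Some: "(P, Some e, Q) \<in> trans E \<longleftrightarrow> (P, e, Q) \<in> trans (self_comp S)"
  by (cases P; cases e; cases Q) (auto simp: eps_self_comp_def Let_def)

lemma trans_E_None:
  assumes "((p, q), None, Q) \<in> trans E"
  shows "p \<in> states S" "q \<in> states S" "Q = (p, p) \<or> Q = (q, q)"
  using assms by (auto simp: eps_self_comp_def Let_def)

text \<open>Used mainly in contrapositive form: if \<open>(p, q)\<close> cannot collapse to
  \<open>(p, p)\<close>, then every successor of \<open>(p, p)\<close> is also a successor of
  \<open>(p, q)\<close>.\<close>

lemma collapse:
  assumes "p \<in> states S" "q \<in> states S" "p \<noteq> q" "cc_step (p, p) Q" "\<not> cc_step (p, q) Q"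
  shows "((p, q), None, (p, p)) \<in> trans E"
proof -
  obtain e where e: "((p, p), e, Q) \<in> trans (self_comp S)" using assms(4) by (auto simp: cc_step_def)
  obtain y z where Q: "Q = (y, z)" by (cases Q)
  have "e \<in> events (self_comp S)" "y \<in> states S" "z \<in> states S"
    using e closed_self_comp states_self_comp by (auto simp: closed_trans_def Q)
  moreover have "\<forall>e. ((p, q), e, Q) \<notin> trans (self_comp S)"
    using assms(5) by (auto simp: cc_step_def)
  ultimately have "\<exists>y3\<in>states S. \<exists>y4\<in>states S.
      (\<exists>e\<in>events (self_comp S). ((p, p), e, (y3, y4)) \<in> trans (self_comp S)) \<and>
      (\<forall>e\<in>events (self_comp S). ((p, q), e, (y3, y4)) \<notin> trans (self_comp S))"
    using e unfolding Q by blast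
  then show ?thesis using assms(1-3) unfolding eps_self_comp_def Let_def by simp
qed

lemma closed_E: "closed_trans E"
proof -
  have "P \<in> states E \<and> e \<in> events E \<and> Q \<in> states E" if "(P, e, Q) \<in> trans E" for P e Q
  proof (cases e)
    case None
    obtain p q where P: "P = (p, q)" by (cases P)
    show ?thesis using trans_E_None[of p q Q] that by (auto simp: None P states_E events_E)
  next
    case (Some e')
    then have "(P, e', Q) \<in> trans (self_comp S)" using that trans_E_Some by simp
    then show ?thesis
      using closed_self_comp states_self_comp by (auto simp: Some closed_trans_def events_E states_E)
  qed
  then show ?thesis by (auto simp: closed_trans_def)
qed

lemma trans_E_obs:
  assumes "(x, t, y) \<in> trans S" "(x', t', y') \<in> trans S" "label S t = Some a" "label S t' = Some a"
  shows "((x, x'), Some (Some t, Some t'), (y, y')) \<in> trans E"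
  using assms label_output[of t a] trans_states
  by (auto simp: trans_E_Some self_comp_def cc_obs_events_def)

lemma trans_E_left:
  assumes "(x, t, y) \<in> trans S" "label S t = None" "z \<in> states S"
  shows "((x, z), Some (Some t, None), (y, z)) \<in> trans E"
  using assms trans_states by (auto simp: trans_E_Some self_comp_def cc_unobs_events_def)

lemma trans_E_right:
  assumes "(x, t, y) \<in> trans S" "label S t = None" "z \<in> states S"
  shows "((z, x), Some (None, Some t), (z, y)) \<in> trans E"
  using assms trans_states by (auto simp: trans_E_Some self_comp_def cc_unobs_events_def)

lemma cc_stepE:
  assumes "cc_step (x, x') (y, y')"
  obtains (obs) t t' a where "(x, t, y) \<in> trans S" "(x', t', y') \<in> trans S"
      "label S t = Some a" "label S t' = Some a"
  | (left) t where "(x, t, y) \<in> trans S" "label S t = None" "x' = y'"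
  | (right) t where "(x', t, y') \<in> trans S" "label S t = None" "x = y"
  using assms unfolding cc_step_def self_comp_def cc_obs_events_def cc_unobs_events_def
  by fastforce

lemma cc_step_obs:
  assumes "(x, t, y) \<in> trans S" "(x', t', y') \<in> trans S" "label S t = Some a" "label S t' = Some a"
  shows "cc_step (x, x') (y, y')"
  using trans_E_obs[OF assms] by (auto simp: trans_E_Some cc_step_def)

lemma cc_step_right:
  assumes "(x, t, y) \<in> trans S" "label S t = None" "z \<in> states S"
  shows "cc_step (z, x) (z, y)"
  using trans_E_right[OF assms] by (auto simp: trans_E_Some cc_step_def)

section \<open>Pairs of the extension versus common estimates\<close>

text \<open>An \<open>\<epsilon>\<close>-transition copies one component onto the other, so a
  component of \<open>Q\<close> may originate from either side of \<open>P\<close>. Hence the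
  conclusion names a component of \<open>P\<close> without fixing which.\<close>

lemma trans_E_projection:
  assumes "(P, e, Q) \<in> trans E" "z \<in> {fst Q, snd Q}"
  shows "\<exists>x\<in>{fst P, snd P}. lpath S x (word_label E [e]) z"
proof -
  obtain p q y y' where PQ: "P = (p, q)" "Q = (y, y')" by (cases P, cases Q)
  show ?thesis
  proof (cases e)
    case None
    then show ?thesis
      using assms trans_E_None[of p q Q]
      by (auto simp: PQ word_label_Cons label_E intro: lpath_refl)
  next
    case (Some e')
    then have "(P, e', Q) \<in> trans (self_comp S)" using assms(1) trans_E_Some by simp
    then consider
      (obs) t t' a where "e' = (Some t, Some t')" "(p, t, y) \<in> trans S" "(q, t', y') \<in> trans S"
        "label S t = Some a" "label S t' = Some a"
    | (left) t where "e' = (Some t, None)" "(p, t, y) \<in> trans S" "label S t = None" "q = y'"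
        "q \<in> states S"
    | (right) t where "e' = (None, Some t)" "(q, t, y') \<in> trans S" "label S t = None" "p = y"
        "p \<in> states S"
      unfolding self_comp_def cc_obs_events_def cc_unobs_events_def PQ by fastforce
    then show ?thesis
      using assms(2) unfolding PQ Some
      by cases (auto simp: word_label_Cons label_E
          intro: lpath_refl lpath_obs[OF closed] lpath_unobs[OF closed])
  qed
qed

lemma lpath_E_projection:
  assumes "lpath E P w Q" "z \<in> {fst Q, snd Q}"
  shows "\<exists>x\<in>{fst P, snd P}. lpath S x w z"
proof -
  obtain s where s: "path E P s Q" "word_label E s = w" using assms(1) unfolding lpath_def by blast
  have "\<exists>x\<in>{fst P, snd P}. lpath S x (word_label E s) z"
    using s(1)
  proof (induction s arbitrary: P)
    case Nil
    then show ?case using assms(2) by (auto simp: states_E intro: lpath_refl)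
  next
    case (Cons e s)
    then obtain P' where P': "(P, e, P') \<in> trans E" "path E P' s Q" by auto
    then obtain x' where x': "x' \<in> {fst P', snd P'}" "lpath S x' (word_label E s) z"
      using Cons.IH by blast
    obtain x where "x \<in> {fst P, snd P}" "lpath S x (word_label E [e]) x'"
      using trans_E_projection[OF P'(1) x'(1)] by blast
    then show ?case
      using lpath_append[OF _ x'(2)] word_label_append[of E "[e]" s] by fastforce
  qed
  then show ?thesis using s(2) by simp
qed

lemma lpath_E_left:
  assumes "lpath S x [] y" "z \<in> states S"
  shows "lpath E (x, z) [] (y, z)"
proof -
  obtain s where "path S x s y" "word_label S s = []" using assms(1) unfolding lpath_def by blast
  then show ?thesis
  proof (induction s arbitrary: x)
    case Nil
    then show ?case using assms(2) by (auto simp: states_E intro: lpath_refl)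
  next
    case (Cons t s)
    then obtain x' where "(x, t, x') \<in> trans S" "label S t = None" "path S x' s y"
      "word_label S s = []" by (auto simp: word_label_Cons split: option.splits)
    then show ?case
      using Cons.IH lpath_unobs[OF closed_E trans_E_left] assms(2) lpath_Nil_append
      by (metis label_E(2) cc_label.simps(1))
  qed
qed

lemma lpath_E_right:
  assumes "lpath S x [] y" "z \<in> states S"
  shows "lpath E (z, x) [] (z, y)"
proof -
  obtain s where "path S x s y" "word_label S s = []" using assms(1) unfolding lpath_def by blast
  then show ?thesis
  proof (induction s arbitrary: x)
    case Nil
    then show ?case using assms(2) by (auto simp: states_E intro: lpath_refl)
  next
    case (Cons t s)
    then obtain x' where "(x, t, x') \<in> trans S" "label S t = None" "path S x' s y"
      "word_label S s = []" by (auto simp: word_label_Cons split: option.splits)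
    then show ?case
      using Cons.IH lpath_unobs[OF closed_E trans_E_right] assms(2) lpath_Nil_append
      by (metis label_E(2) cc_label.simps(2))
  qed
qed

text \<open>The two paths are synchronized at their observable events; the silent stretches in
  between are executed first on the left, then on the right.\<close>

lemma lpath_E_pair:
  assumes "lpath S x w y" "lpath S x' w y'"
  shows "lpath E (x, x') w (y, y')"
  using assms
proof (induction w arbitrary: x x')
  case Nil
  then show ?case
    using lpath_Nil_append lpath_E_left lpath_E_right lpath_states[OF closed] by metis
next
  case (Cons a w)
  obtain z t u where 1: "lpath S x [] z" "(z, t, u) \<in> trans S" "label S t = Some a" "lpath S u w y"
    using lpath_ConsE[OF closed Cons.prems(1)] by blast
  obtain z' t' u' where 2: "lpath S x' [] z'" "(z', t', u') \<in> trans S" "label S t' = Some a"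
    "lpath S u' w y'"
    using lpath_ConsE[OF closed Cons.prems(2)] by blast
  have "lpath E (x, x') [] (z, x')" "lpath E (z, x') [] (z, z')"
    using 1(1) 2(1) lpath_E_left lpath_E_right lpath_states[OF closed] by metis+
  then have "lpath E (x, x') [] (z, z')" by (rule lpath_Nil_append)
  moreover have "lpath E (z, z') [a] (u, u')"
    using lpath_obs[OF closed_E trans_E_obs[OF 1(2) 2(2) 1(3) 2(3)]] 1(3) by (simp add: label_E)
  ultimately have "lpath E (x, x') [a] (u, u')" by (rule lpath_Nil_append)
  from lpath_append[OF this Cons.IH[OF 1(4) 2(4)]] show ?case by simp
qed

lemma reachable_E_if_estimate:
  assumes "x \<in> estimate S w" "y \<in> estimate S w"
  shows "reachable E (x, y)"
  using assms lpath_E_pair unfolding estimate_iff_lpath[OF closed] reachable_iff_lpath init_E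
  by blast

text \<open>Both components trace back, with the same label word, to components of an initial pair,
  and these are all initial states of \<open>S\<close>. The two traces may start on the same
  side.\<close>

lemma estimate_if_reachable_E:
  assumes "reachable E (x, y)"
  obtains w where "x \<in> estimate S w" "y \<in> estimate S w"
proof -
  obtain P w where P: "P \<in> init S \<times> init S" "lpath E P w (x, y)"
    using assms unfolding reachable_iff_lpath init_E by blast
  have "z \<in> estimate S w" if "z \<in> {x, y}" for z
    using lpath_E_projection[OF P(2), of z] that P(1) unfolding estimate_iff_lpath[OF closed] by auto
  then show thesis using that by blast
qed

section \<open>Extending ambiguous pairs backwards\<close>

definition silently_divergent :: "'x \<Rightarrow> bool" where
  "silently_divergent x \<longleftrightarrow> (\<exists>s\<^sub>1 s\<^sub>2 x'. s\<^sub>1 \<in> lists (unobs_events S) \<and>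
     s\<^sub>2 \<in> lists (unobs_events S) \<and> s\<^sub>2 \<noteq> [] \<and> x' \<in> states S \<and>
     path S x s\<^sub>1 x' \<and> path S x' s\<^sub>2 x')"

text \<open>As a relation on pairs, it turns the cycles of condition (ii) into loops of relational
  powers, to which a pigeonhole argument applies. The label is existential because tracing backwards
  does not preserve the original labels.\<close>

definition amb_step :: "(('x \<times> 'x) \<times> ('x \<times> 'x)) set" where
  "amb_step = {(P, Q). fst P \<noteq> snd P \<and> fst Q \<noteq> snd Q \<and> (\<exists>a. lpath E P [a] Q)}"

definition silent_ambiguity :: bool where
  "silent_ambiguity \<longleftrightarrow> (\<exists>x y. reachable E (x, y) \<and> x \<noteq> y \<and> silently_divergent x)"

definition cyclic_ambiguity :: bool where
  "cyclic_ambiguity \<longleftrightarrow> (\<exists>P n. n > 0 \<and> reachable E P \<and> (P, P) \<in> amb_step ^^ n)"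

lemma silently_divergentI:
  assumes "lpath S x [] x'" "(x', t, y) \<in> trans S" "label S t = None" "lpath S y [] x'"
  shows "silently_divergent x"
proof -
  obtain s1 where s1: "path S x s1 x'" "s1 \<in> lists (events S)" "word_label S s1 = []"
    using assms(1) unfolding lpath_def by blast
  obtain s2 where s2: "path S y s2 x'" "s2 \<in> lists (events S)" "word_label S s2 = []"
    using assms(4) unfolding lpath_def by blast
  have "t \<in> unobs_events S" using trans_states[OF assms(2)] assms(3) by (simp add: unobs_events_def)
  moreover have "path S x' (t # s2) x'" using s2(1) assms(2) by auto
  ultimately show ?thesis
    unfolding silently_divergent_def
    using s1 s2 unobs_if_word_label_Nil trans_states[OF assms(2)]
    by (intro exI[of _ s1] exI[of _ "t # s2"] exI[of _ x']) auto
qed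

lemma silently_divergent_self_loop:
  assumes "(x, t, x) \<in> trans S" "label S t = None"
  shows "silently_divergent x"
  using silently_divergentI[OF _ assms] trans_states[OF assms(1)] lpath_refl[of x S] by auto

lemma silent_ambiguityI:
  assumes "x \<in> estimate S w" "y \<in> estimate S w" "x \<noteq> y" "silently_divergent x"
  shows silent_ambiguity
  using assms(3,4) reachable_E_if_estimate[OF assms(1,2)] unfolding silent_ambiguity_def by blast

lemma cyclic_ambiguityI:
  assumes "reachable E (x, y)" "x \<noteq> y" "lpath E (x, y) [a] (x, y)"
  shows cyclic_ambiguity
  unfolding cyclic_ambiguity_def
  by (rule exI[of _ "(x, y)"], rule exI[of _ 1]) (use assms in \<open>auto simp: amb_step_def\<close>)

section \<open>Consequences of a missing collapse\<close>

text \<open>The pair \<open>(p, y)\<close> is ambiguous. If it reaches \<open>(p, p)\<close> with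
  one label, the silent step from \<open>p\<close> to \<open>y\<close> leads back, which gives (ii).
  Otherwise \<open>y\<close> returns silently to \<open>p\<close>, which gives (i).\<close>

lemma ambiguity_if_obs_self_loop:
  assumes p: "p \<in> estimate S w" "(p, u, y) \<in> trans S" "label S u = None"
    and loop: "(p, t, p) \<in> trans S" "label S t = Some a" and "y \<noteq> p"
  shows "silent_ambiguity \<or> cyclic_ambiguity"
proof -
  have py: "lpath S p [] y" using lpath_unobs[OF closed p(2,3)] .
  have st: "p \<in> states S" "y \<in> states S" using trans_states[OF p(2)] by auto
  have y: "y \<in> estimate S w" by (rule estimate_unobs[OF closed p(1) py])
  have reach: "reachable E (p, y)" by (rule reachable_E_if_estimate[OF p(1) y])
  have pp_py: "lpath E (p, p) [] (p, y)" by (rule lpath_E_right[OF py st(1)])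
  have cyc: "lpath E (p, y) [b] (p, p) \<Longrightarrow> cyclic_ambiguity" for b
    using cyclic_ambiguityI[OF reach _ lpath_append_Nil[OF _ pp_py]] \<open>y \<noteq> p\<close> by auto
  \<comment> \<open>The loop taken in both components makes \<open>(p, p)\<close> its own successor,
    so the rule for \<open>\<epsilon>\<close>-transitions can be tested with target
    \<open>(p, p)\<close>.\<close>
  have pp: "cc_step (p, p) (p, p)" by (rule cc_step_obs[OF loop(1,1,2,2)])
  show ?thesis
  proof (cases "cc_step (p, y) (p, p)")
    case False
    then have "((p, y), None, (p, p)) \<in> trans E" using collapse[OF st _ pp] \<open>y \<noteq> p\<close> by auto
    then have "lpath E (p, y) [] (p, p)" using lpath_unobs[OF closed_E] label_E by blast
    moreover have "lpath E (p, p) [a] (p, p)" using lpath_E_pair lpath_obs[OF closed loop] by blast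
    ultimately have "lpath E (p, y) [a] (p, p)" by (rule lpath_Nil_append)
    then show ?thesis using cyc by blast
  next
    case True
    then show ?thesis
    proof (cases rule: cc_stepE)
      case (obs t1 t2 b)
      have "lpath E (p, y) [b] (p, p)"
        using lpath_E_pair lpath_obs[OF closed obs(1,3)] lpath_obs[OF closed obs(2,4)] by blast
      then show ?thesis using cyc by blast
    next
      case left
      then show ?thesis using \<open>y \<noteq> p\<close> by blast
    next
      case (right u')
      then have "lpath S y [] p" using lpath_unobs[OF closed] by blast
      then have "silently_divergent p"
        by (rule silently_divergentI[OF lpath_refl[OF st(1)] p(2,3)])
      then show ?thesis using silent_ambiguityI[OF p(1) y] \<open>y \<noteq> p\<close> by auto
    qed
  qed
qed

text \<open>The silent step in the right component leads from \<open>(p, p)\<close> to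
  \<open>(p, y)\<close>, so \<open>(p, q)\<close> must reach \<open>(p, y)\<close> as well. Unless
  \<open>q\<close> itself moves silently to \<open>y\<close>, this requires a self-loop at
  \<open>p\<close>: a silent one yields (i), an observable one is covered by
  \<open>ambiguity_if_obs_self_loop\<close>.\<close>

lemma unobs_step_transfer:
  assumes p: "p \<in> estimate S w" and q: "q \<in> estimate S w" "p \<noteq> q"
    and no_collapse: "\<forall>Q. cc_step (p, p) Q \<longrightarrow> cc_step (p, q) Q"
    and u: "(p, u, y) \<in> trans S" "label S u = None"
    and no_amb: "\<not> silent_ambiguity" "\<not> cyclic_ambiguity"
  shows "\<exists>t. (q, t, y) \<in> trans S \<and> label S t = None"
proof -
  have st: "p \<in> states S" using trans_states[OF u(1)] by auto
  have "y \<noteq> p"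
  proof
    assume "y = p"
    then have "silently_divergent p" using silently_divergent_self_loop u by blast
    then show False using silent_ambiguityI[OF p q] no_amb(1) by blast
  qed
  have "cc_step (p, q) (p, y)" by (rule no_collapse[rule_format, OF cc_step_right[OF u st]])
  then show ?thesis
  proof (cases rule: cc_stepE)
    case (obs t t' a)
    then show ?thesis using ambiguity_if_obs_self_loop[OF p u obs(1,3) \<open>y \<noteq> p\<close>] no_amb by blast
  next
    case (left t)
    then have "silently_divergent p" using silently_divergent_self_loop by blast
    then show ?thesis using silent_ambiguityI[OF p q] no_amb(1) by blast
  next
    case (right t)
    then show ?thesis by blast
  qed
qed

text \<open>The label \<open>b\<close> may differ from \<open>a\<close>: the \<open>\<epsilon>\<close>-transitions of the extension are suppressed as
  soon as some event, with whatever label, leads directly to the same pair.\<close>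

lemma split_pair:
  assumes p: "p \<in> estimate S w" and q: "q \<in> estimate S w" "p \<noteq> q"
    and x: "lpath S p [a] x" and y: "lpath S p [a] y"
    and no_amb: "\<not> silent_ambiguity" "\<not> cyclic_ambiguity"
  shows "\<exists>b. lpath E (p, q) [b] (x, y) \<or> lpath E (q, p) [b] (x, y)"
proof (cases "\<forall>Q. cc_step (p, p) Q \<longrightarrow> cc_step (p, q) Q")
  case False
  have "p \<in> states S" "q \<in> states S" using p q by (auto simp: estimate_def)
  then have "((p, q), None, (p, p)) \<in> trans E" using False collapse q(2) by blast
  then have "lpath E (p, q) [] (p, p)" using lpath_unobs[OF closed_E] label_E by blast
  then have "lpath E (p, q) [a] (x, y)" by (rule lpath_Nil_append[OF _ lpath_E_pair[OF x y]])
  then show ?thesis by blast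
next
  case True
  note no_collapse = True[rule_format]
  note transfer = unobs_step_transfer[OF p q True _ _ no_amb]
  note lp_unobs = lpath_Nil_append[OF lpath_unobs[OF closed]]
  note lp_obs = lpath_append_Nil[OF lpath_obs[OF closed]]
  \<comment> \<open>If either path starts silently, \<open>q\<close> can imitate its first step and
    then follow the rest, so it replaces \<open>p\<close> in that component.\<close>
  from x show ?thesis
  proof (cases rule: lpath_single_cases[OF closed, consumes 1, case_names unobs obs])
    case (unobs t z)
    have "lpath S q [a] x" using transfer[OF unobs(1,2)] lp_unobs[OF _ _ unobs(3)] by blast
    then show ?thesis using lpath_E_pair y by blast
  next
    case x': (obs t z)
    from y show ?thesis
    proof (cases rule: lpath_single_cases[OF closed, consumes 1, case_names unobs obs])
      case (unobs t' z')
      have "lpath S q [a] y" using transfer[OF unobs(1,2)] lp_unobs[OF _ _ unobs(3)] by blast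
      then show ?thesis using lpath_E_pair x by blast
    next
      case y': (obs t' z')
      \<comment> \<open>Both paths now start with an observable event, so \<open>(z, z')\<close> and
        the swapped pair \<open>(z', z)\<close> are successors of \<open>(p, p)\<close>. If
        \<open>(p, q)\<close> reaches either one observably, the paths can be completed; the
        remaining silent cases for the two orders are combined.\<close>
      have "cc_step (p, q) (z, z')"
        by (rule no_collapse[OF cc_step_obs[OF x'(1) y'(1) x'(2) y'(2)]])
      then show ?thesis
      proof (cases rule: cc_stepE)
        case (obs s s' b)
        then show ?thesis
          using lpath_E_pair lp_obs[OF obs(1,3) x'(3)] lp_obs[OF obs(2,4) y'(3)] by blast
      next
        case left
        have "cc_step (p, q) (z', z)"
          by (rule no_collapse[OF cc_step_obs[OF y'(1) x'(1) y'(2) x'(2)]])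
        then show ?thesis
        proof (cases rule: cc_stepE)
          case (obs s s' b)
          then show ?thesis
            using lpath_E_pair lp_obs[OF obs(1,3) y'(3)] lp_obs[OF obs(2,4) x'(3)] by blast
        next
          case left2: (left s)
          have "q = z" "q = z'" using left left2 by auto
          \<comment> \<open>Here \<open>p\<close> moves silently to \<open>q\<close>; transferring
            this very step to \<open>q\<close> produces a silent self-loop at
            \<open>q\<close>.\<close>
          then obtain s' where "(q, s', q) \<in> trans S" "label S s' = None"
            using transfer[of _ q] left by blast
          then have "silently_divergent q" by (rule silently_divergent_self_loop)
          then show ?thesis using silent_ambiguityI[OF q(1) p] q(2) no_amb(1) by blast
        next
          case (right s)
          then show ?thesis using left q(2) by blast
        qed
      next
        case (right s)
        have "cc_step (p, q) (z', z)"
          by (rule no_collapse[OF cc_step_obs[OF y'(1) x'(1) y'(2) x'(2)]])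
        then show ?thesis
        proof (cases rule: cc_stepE)
          case (obs s s' b)
          then show ?thesis
            using lpath_E_pair lp_obs[OF obs(1,3) y'(3)] lp_obs[OF obs(2,4) x'(3)] by blast
        next
          case (left s')
          then show ?thesis using right q(2) by blast
        next
          case right2: (right s')
          \<comment> \<open>In this case \<open>z\<close> and \<open>z'\<close> both equal
            \<open>p\<close>, and \<open>q\<close> moves silently to \<open>p\<close>, so
            \<open>q\<close> can follow the whole path from \<open>p\<close> to
            \<open>x\<close>.\<close>
          then have "lpath S q [a] x" using right lp_unobs[OF right2(1,2), of "[a]" x] x by auto
          then show ?thesis using lpath_E_pair y by blast
        qed
      qed
    qed
  qed
qed

section \<open>Chains of ambiguous pairs and the pigeonhole argument\<close>

text \<open>The induction removes labels from the right end and keeps the final pair arbitrary,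
  since each predecessor pair can be chosen only after its successor is known.\<close>

lemma ambiguous_chain:
  assumes no_amb: "\<not> silent_ambiguity" "\<not> cyclic_ambiguity"
    and amb: "\<And>j. j \<le> length w \<Longrightarrow>
      \<exists>x\<in>estimate S (v @ take j w). \<exists>y\<in>estimate S (v @ take j w). x \<noteq> y"
    and xy: "x \<in> estimate S (v @ w)" "y \<in> estimate S (v @ w)" "x \<noteq> y"
  shows "\<exists>P. reachable E P \<and> (P, (x, y)) \<in> amb_step ^^ length w"
  using amb xy
proof (induction w arbitrary: x y rule: rev_induct)
  case Nil
  then show ?case using reachable_E_if_estimate by fastforce
next
  case (snoc a w)
  have amb_w: "\<exists>x\<in>estimate S (v @ take j w). \<exists>y\<in>estimate S (v @ take j w). x \<noteq> y"
    if "j \<le> length w" for j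
    using snoc.prems(1)[of j] that by simp
  obtain p where p: "p \<in> estimate S (v @ w)" "lpath S p [a] x"
    using estimate_appendE[OF closed, of x "v @ w" "[a]"] snoc.prems(2) by auto
  obtain p' where p': "p' \<in> estimate S (v @ w)" "lpath S p' [a] y"
    using estimate_appendE[OF closed, of y "v @ w" "[a]"] snoc.prems(3) by auto
  have "\<exists>P b. P \<in> estimate S (v @ w) \<times> estimate S (v @ w) \<and> fst P \<noteq> snd P \<and> lpath E P [b] (x, y)"
  proof (cases "p = p'")
    case False
    then show ?thesis
      using p p' lpath_E_pair[OF p(2) p'(2)] by (intro exI[of _ "(p, p')"] exI[of _ a]) simp
  next
    case True
    obtain q where q: "q \<in> estimate S (v @ w)" "p \<noteq> q" using amb_w[of "length w"] by auto
    obtain b where "lpath E (p, q) [b] (x, y) \<or> lpath E (q, p) [b] (x, y)"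
      using split_pair[OF p(1) q p(2) _ no_amb] p'(2) True by blast
    then show ?thesis
    proof
      assume "lpath E (p, q) [b] (x, y)"
      then show ?thesis using p q by (intro exI[of _ "(p, q)"] exI[of _ b]) simp
    next
      assume "lpath E (q, p) [b] (x, y)"
      then show ?thesis using p q by (intro exI[of _ "(q, p)"] exI[of _ b]) simp
    qed
  qed
  then obtain p q b where pq: "p \<in> estimate S (v @ w)" "q \<in> estimate S (v @ w)" "p \<noteq> q"
    "lpath E (p, q) [b] (x, y)" by auto
  obtain P where "reachable E P" "(P, (p, q)) \<in> amb_step ^^ length w"
    using snoc.IH[OF amb_w pq(1-3)] by blast
  moreover have "((p, q), (x, y)) \<in> amb_step"
    using pq snoc.prems(4) by (auto simp: amb_step_def)
  ultimately show ?case by (intro exI[of _ P]) (auto intro: relpow_Suc_I)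
qed

lemma reachable_amb_step:
  assumes "reachable E P" "(P, Q) \<in> amb_step ^^ n"
  shows "reachable E Q"
  using assms(2)
proof (induction n arbitrary: Q)
  case 0
  then show ?case using assms(1) by simp
next
  case (Suc n)
  then obtain Q' where "(P, Q') \<in> amb_step ^^ n" "(Q', Q) \<in> amb_step" by auto
  then obtain a where "lpath E Q' [a] Q" unfolding amb_step_def by blast
  then show ?case using reachable_lpath[OF Suc.IH[OF \<open>(P, Q') \<in> amb_step ^^ n\<close>]] by simp
qed

lemma reachable_states: "reachable E P \<Longrightarrow> P \<in> states S \<times> states S"
  using lpath_states(2)[OF closed_E] states_E unfolding reachable_iff_lpath by blast

lemma finite_states: "finite (states S)"
  using is_fsa by (simp add: is_fsa_def)

text \<open>A chain of \<open>n\<close> steps visits \<open>n + 1\<close> positions, so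
  \<open>n\<close> equal to the number of pairs already forces a repetition.\<close>

lemma cyclic_ambiguity_if_long_chain:
  assumes "reachable E P" "(P, Q) \<in> amb_step ^^ n" "card (states S \<times> states S) \<le> n"
  shows cyclic_ambiguity
proof -
  obtain f where f: "f 0 = P" "f n = Q" "\<forall>i<n. (f i, f (Suc i)) \<in> amb_step"
    using assms(2) unfolding relpow_fun_conv by blast
  have sub: "(f i, f j) \<in> amb_step ^^ (j - i)" if "i \<le> j" "j \<le> n" for i j
    unfolding relpow_fun_conv
    using f(3) that by (intro exI[of _ "\<lambda>k. f (i + k)"]) auto
  have reach: "reachable E (f i)" if "i \<le> n" for i
    using reachable_amb_step[OF assms(1)] sub[of 0 i] that f(1) by auto
  have "f ` {..n} \<subseteq> states S \<times> states S" using reach reachable_states by blast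
  then have "card (f ` {..n}) < card {..n}"
    using card_mono[of "states S \<times> states S" "f ` {..n}"] finite_states assms(3) by simp
  then have "\<not> inj_on f {..n}" by (rule pigeonhole)
  then obtain i j where ij: "i < j" "j \<le> n" "f i = f j"
    unfolding inj_on_def by (metis atMost_iff linorder_neqE_nat)
  then show ?thesis
    using reach[of i] sub[of i j] unfolding cyclic_ambiguity_def
    by (intro exI[of _ "f i"] exI[of _ "j - i"]) auto
qed

lemma ambiguity_if_not_detectable:
  assumes "\<not> strongly_periodically_detectable S"
  shows "silent_ambiguity \<or> cyclic_ambiguity"
proof (rule ccontr)
  assume "\<not> (silent_ambiguity \<or> cyclic_ambiguity)"
  then have no_amb: "\<not> silent_ambiguity" "\<not> cyclic_ambiguity" by auto
  \<comment> \<open>Non-detectability is instantiated with the bound \<open>Suc N\<close>: all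
    continuations of \<open>s'\<close> along \<open>s\<close> with at most \<open>N\<close> labels
    fail to give a singleton estimate.\<close>
  define N where "N = card (states S \<times> states S)"
  obtain s s' where s: "s \<in> omega_lang S" "is_prefix s' s"
    and not_1: "\<And>s''. s'' \<in> lists (events S) \<Longrightarrow> length (word_label S s'') < Suc N \<Longrightarrow>
      is_prefix (s' @ s'') s \<Longrightarrow> card (estimate S (word_label S (s' @ s''))) \<noteq> 1"
    using assms unfolding strongly_periodically_detectable_def by (metis zero_less_Suc)
  have ev: "s i \<in> events S" for i using s(1) by (auto simp: omega_lang_def)
  obtain r where r: "r 0 \<in> init S" "\<And>i. r i \<in> states S" "\<And>i. (r i, s i, r (Suc i)) \<in> trans S"
    using s(1) by (auto simp: omega_lang_def)
  have run: "path S (r i) (map s [i..<i + n]) (r (i + n))" for i n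
  proof (induction n)
    case 0
    then show ?case using r(2) by simp
  next
    case (Suc n)
    have "path S (r (i + n)) [s (i + n)] (r (i + Suc n))" using r(2,3) by auto
    from path_append[OF Suc this] show ?case by simp
  qed
  have in_events: "map s [i..<j] \<in> lists (events S)" for i j using ev by auto
  define m where "m = length s'"
  define V where "V n = map s [m..<m + n]" for n
  have s'_V: "s' @ V n = map s [0..<m + n]" for n
  proof -
    have "s' = map s [0..<m]" using s(2) by (simp add: is_prefix_def m_def subsequence_def)
    then show ?thesis using upt_add_eq_append[of 0 m n] unfolding V_def by simp
  qed
  have run_est: "r (m + n) \<in> estimate S (word_label S (s' @ V n))" for n
    using lpathI[OF closed run[of 0 "m + n"]] r(1)
    unfolding estimate_iff_lpath[OF closed] s'_V by auto
  \<comment> \<open>The state of the run itself always lies in the estimate, so an estimate that is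
    not a singleton contains a second state.\<close>
  have ambig: "\<exists>y\<in>estimate S (word_label S (s' @ V n)). r (m + n) \<noteq> y"
    if "length (word_label S (V n)) \<le> N" for n
  proof (rule ccontr)
    assume "\<not> ?thesis"
    then have "estimate S (word_label S (s' @ V n)) = {r (m + n)}" using run_est by auto
    moreover have "is_prefix (s' @ V n) s" unfolding is_prefix_def s'_V by (simp add: subsequence_def)
    ultimately show False using not_1[of "V n"] that in_events unfolding V_def by auto
  qed
  show False
  proof (cases "\<exists>n. N \<le> length (word_label S (V n))")
    case True
    then obtain n where n: "N \<le> length (word_label S (V n))" by blast
    define w where "w = take N (word_label S (V n))"
    have len_w: "length w = N" using n by (simp add: w_def)
    have amb: "\<exists>x\<in>estimate S (word_label S s' @ take j w).
        \<exists>y\<in>estimate S (word_label S s' @ take j w). x \<noteq> y" if "j \<le> length w" for j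
    proof -
      have j: "j \<le> length (word_label S (V n))" using that n len_w by simp
      obtain i where i: "i \<le> length (V n)"
          "take j (word_label S (V n)) = word_label S (take i (V n))"
        using take_word_label[OF j] by blast
      \<comment> \<open>Every prefix of \<open>w\<close> is thus the label of some
        \<open>V i\<close> along the run, and \<open>ambig\<close> applies to it.\<close>
      have "take i (V n) = V i" using i(1) by (simp add: V_def take_map)
      then have Vi: "word_label S (V i) = take j w"
        using i(2) that len_w by (simp add: w_def min_absorb1)
      then have "length (word_label S (V i)) \<le> N" using len_w by simp
      from ambig[OF this] run_est[of i] show ?thesis by (auto simp: Vi)
    qed
    obtain x y where "x \<in> estimate S (word_label S s' @ w)" "y \<in> estimate S (word_label S s' @ w)"
      "x \<noteq> y" using amb[of "length w"] by auto
    then obtain P where P: "reachable E P" "(P, (x, y)) \<in> amb_step ^^ length w"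
      using ambiguous_chain[OF no_amb amb] by blast
    then have cyclic_ambiguity
      by (rule cyclic_ambiguity_if_long_chain) (simp add: len_w N_def)
    then show False using no_amb(2) by blast
  next
    case False
    then have bound: "length (word_label S (V n)) < N" for n by (meson not_le)
    \<comment> \<open>The label counts are bounded, hence attain a maximum; after this position the
      run is silent forever.\<close>
    obtain n where n: "\<And>n'. length (word_label S (V n')) \<le> length (word_label S (V n))"
      using ex_has_greatest_nat[of "\<lambda>_. True" 0 "\<lambda>n. length (word_label S (V n))" N] bound
        less_imp_le by auto
    define M where "M = m + n"
    have silent: "map s [M + i..<M + j] \<in> lists (unobs_events S)" if "i \<le> j" for i j
    proof -
      have "V (n + j) = V n @ map s [M..<M + j]"
        using upt_add_eq_append[of m "m + n" j] unfolding V_def M_def by (simp add: add.assoc)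
      then have "word_label S (map s [M..<M + j]) = []" using n[of "n + j"] by simp
      then have "map s [M..<M + j] \<in> lists (unobs_events S)"
        using unobs_if_word_label_Nil in_events by blast
      then show ?thesis by auto
    qed
    \<comment> \<open>The silent tail repeats a state, and the stretch between the two visits is the
      unobservable cycle.\<close>
    have "finite (range (\<lambda>i. r (M + i)))"
      by (rule finite_subset[OF _ finite_states]) (use r(2) in auto)
    then have "\<not> inj (\<lambda>i. r (M + i))" using finite_imageD by blast
    then obtain i j where ij: "i < j" "r (M + i) = r (M + j)"
      unfolding inj_on_def by (metis linorder_neqE_nat)
    have "path S (r M) (map s [M + 0..<M + i]) (r (M + i))" using run by simp
    moreover have "path S (r (M + i)) (map s [M + i..<M + j]) (r (M + i))"
      using run[of "M + i" "j - i"] ij by simp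
    ultimately have "silently_divergent (r M)"
      using silent[of 0 i] silent[of i j] ij(1) r(2)
      unfolding silently_divergent_def
      by (intro exI[of _ "map s [M + 0..<M + i]"] exI[of _ "map s [M + i..<M + j]"]
          exI[of _ "r (M + i)"]) auto
    moreover obtain y where "y \<in> estimate S (word_label S (s' @ V n))" "r M \<noteq> y"
      using ambig[of n] bound[of n] unfolding M_def by auto
    ultimately show False using silent_ambiguityI run_est[of n] no_amb(1) unfolding M_def by blast
  qed
qed

section \<open>Ambiguous infinite runs\<close>

text \<open>Detectability is refuted at the prefix \<open>u\<close> of the lasso for every bound
  \<open>k\<close> at once, because no continuation along the cycle ever has a singleton
  estimate.\<close>

lemma not_detectableI:
  assumes "x \<in> init S" and u: "path S x u p" and v: "path S p v p" "v \<noteq> []"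
    and amb: "\<And>s s' n. s @ s' = concat (replicate n v) \<Longrightarrow>
      \<exists>y\<in>estimate S (word_label S (u @ s)). \<exists>z\<in>estimate S (word_label S (u @ s)). y \<noteq> z"
  shows "\<not> strongly_periodically_detectable S"
proof
  assume "strongly_periodically_detectable S"
  moreover have "u \<frown> v\<^sup>\<omega> \<in> omega_lang S" by (rule lasso_in_omega_lang[OF closed assms(1) u v])
  moreover have "is_prefix u (u \<frown> v\<^sup>\<omega>)" by (simp add: is_prefix_def)
  ultimately obtain s where s: "is_prefix (u @ s) (u \<frown> v\<^sup>\<omega>)"
    "card (estimate S (word_label S (u @ s))) = 1"
    unfolding strongly_periodically_detectable_def by blast
  obtain s' where "s @ s' = concat (replicate (length s) v)" using is_prefix_lasso[OF s(1) v(2)] .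
  from amb[OF this] s(2) show False by (auto simp: card_1_singleton_iff)
qed

text \<open>Once \<open>u\<close> has been read, the run to and around the silent cycle emits
  nothing, so the estimate stays the one after \<open>w\<close>, which contains both
  \<open>x\<close> and \<open>y\<close>.\<close>

lemma not_detectable_if_silent_ambiguity:
  assumes silent_ambiguity
  shows "\<not> strongly_periodically_detectable S"
proof -
  obtain x y where xy: "reachable E (x, y)" "x \<noteq> y" "silently_divergent x"
    using assms unfolding silent_ambiguity_def by blast
  obtain w where w: "x \<in> estimate S w" "y \<in> estimate S w"
    using estimate_if_reachable_E[OF xy(1)] .
  obtain x0 u where u: "x0 \<in> init S" "path S x0 u x" "word_label S u = w"
    using w(1) unfolding estimate_def by blast
  obtain s1 s2 x' where s: "s1 \<in> lists (unobs_events S)" "s2 \<in> lists (unobs_events S)" "s2 \<noteq> []"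
    "path S x s1 x'" "path S x' s2 x'"
    using xy(3) unfolding silently_divergent_def by blast
  show ?thesis
  proof (rule not_detectableI[OF u(1) path_append[OF u(2) s(4)] s(5,3)])
    fix s s' n assume "s @ s' = concat (replicate n s2)"
    moreover have "concat (replicate n s2) \<in> lists (unobs_events S)"
      using s(2) by (induction n) auto
    ultimately have "s \<in> lists (unobs_events S)" by (metis append_in_lists_conv)
    then have "word_label S ((u @ s1) @ s) = w" 
      using u(3) word_label_unobs[OF s(1)] word_label_unobs[of s S] by simp
    then show "\<exists>y\<in>estimate S (word_label S ((u @ s1) @ s)).
        \<exists>z\<in>estimate S (word_label S ((u @ s1) @ s)). y \<noteq> z"
      using w xy(2) by auto
  qed
qed

section \<open>Label words with persistent ambiguity\<close>

text \<open>Each prefix has its own witness \<open>R\<close>, which need not lie on the path to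
  \<open>Q\<close>: an estimate depends only on the label word read so far.\<close>

definition amb_word :: "'x \<times> 'x \<Rightarrow> 'o list \<Rightarrow> 'x \<times> 'x \<Rightarrow> bool" where
  "amb_word P w Q \<longleftrightarrow> lpath E P w Q \<and>
     (\<forall>u v. w = u @ v \<longrightarrow> (\<exists>R. lpath E P u R \<and> fst R \<noteq> snd R))"

lemma amb_word_append:
  assumes "amb_word P w Q" "amb_word Q w' R"
  shows "amb_word P (w @ w') R"
  unfolding amb_word_def
proof (intro conjI allI impI)
  have PQ: "lpath E P w Q" and QR: "lpath E Q w' R" using assms unfolding amb_word_def by auto
  show "lpath E P (w @ w') R" by (rule lpath_append[OF PQ QR])
  fix u v assume "w @ w' = u @ v"
  then consider (1) us where "w = u @ us" | (2) us where "u = w @ us" "w' = us @ v"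
    by (auto simp: append_eq_append_conv2)
  then show "\<exists>R. lpath E P u R \<and> fst R \<noteq> snd R"
  proof cases
    case 1
    then show ?thesis using assms(1) unfolding amb_word_def by blast
  next
    case 2
    obtain R' where "lpath E Q us R'" "fst R' \<noteq> snd R'"
      using assms(2) 2(2) unfolding amb_word_def by blast
    with lpath_append[OF PQ] 2(1) show ?thesis by blast
  qed
qed

lemma amb_word_Nil: "P \<in> states E \<Longrightarrow> fst P \<noteq> snd P \<Longrightarrow> amb_word P [] P"
  using lpath_refl[of P E] unfolding amb_word_def by blast

lemma amb_word_single:
  assumes "lpath E P [a] Q" "fst P \<noteq> snd P" "fst Q \<noteq> snd Q"
  shows "amb_word P [a] Q"
proof -
  have "lpath E P [] P" by (rule lpath_refl[OF lpath_states(1)[OF closed_E assms(1)]])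
  then show ?thesis using assms unfolding amb_word_def Cons_eq_append_conv by blast
qed

lemma amb_word_if_amb_step:
  assumes "(P, Q) \<in> amb_step ^^ n" "P \<in> states E" "fst P \<noteq> snd P"
  shows "\<exists>w. length w = n \<and> amb_word P w Q"
  using assms(1)
proof (induction n arbitrary: Q)
  case 0
  then show ?case using amb_word_Nil assms(2,3) by auto
next
  case (Suc n)
  then obtain Q' where Q': "(P, Q') \<in> amb_step ^^ n" "(Q', Q) \<in> amb_step" by auto
  then obtain w where "length w = n" "amb_word P w Q'" using Suc.IH by blast
  moreover obtain a where "amb_word Q' [a] Q"
    using Q'(2) amb_word_single unfolding amb_step_def by blast
  ultimately show ?case using amb_word_append by (intro exI[of _ "w @ [a]"]) auto
qed

lemma amb_word_replicate:
  assumes "amb_word P w P" "fst P \<noteq> snd P"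
  shows "amb_word P (concat (replicate n w)) P"
proof (induction n)
  case 0
  have "P \<in> states E" using assms lpath_states(1)[OF closed_E] unfolding amb_word_def by blast
  then show ?case using amb_word_Nil assms(2) by simp
next
  case (Suc n)
  then show ?case using amb_word_append[OF assms(1)] by simp
qed

lemma not_detectable_if_cyclic_ambiguity:
  assumes cyclic_ambiguity
  shows "\<not> strongly_periodically_detectable S"
proof -
  obtain P n where P: "n > 0" "reachable E P" "(P, P) \<in> amb_step ^^ n"
    using assms unfolding cyclic_ambiguity_def by blast
  obtain x y where xy: "P = (x, y)" by (cases P)
  have ne: "fst P \<noteq> snd P" using P(1,3) by (cases n) (auto simp: amb_step_def)
  have "P \<in> states E" using reachable_states[OF P(2)] states_E by simp
  then obtain w where "length w = n" and w: "amb_word P w P"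
    using amb_word_if_amb_step[OF P(3)] ne by auto
  then have "w \<noteq> []" using P(1) by auto
  obtain v where v: "x \<in> estimate S v" "y \<in> estimate S v"
    using estimate_if_reachable_E P(2) xy by blast
  have pred: "\<exists>p\<in>{x, y}. lpath S p w z" if "z \<in> {x, y}" for z
    using lpath_E_projection[of P w P z] w that unfolding amb_word_def xy by simp
  have "\<exists>p\<in>{x, y}. \<exists>k>0. lpath S p (concat (replicate k w)) p"
  proof (cases "lpath S x w x \<or> lpath S y w y")
    case True
    then show ?thesis by (auto intro!: exI[of _ "Suc 0"])
  next
    case False
    \<comment> \<open>By \<open>pred\<close>, each state has a predecessor among the two; if neither
      precedes itself, they precede each other, and two rounds close a cycle.\<close>
    then have "lpath S x w y" "lpath S y w x" using pred by blast+
    then have "lpath S x (w @ w) x" by (rule lpath_append)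
    then show ?thesis by (auto intro!: exI[of _ "Suc (Suc 0)"])
  qed
  then obtain p k where p: "p \<in> {x, y}" "k > 0" "lpath S p (concat (replicate k w)) p" by blast
  define w' where "w' = concat (replicate k w)"
  \<comment> \<open>The cycle of \<open>p\<close> may take several rounds of \<open>w\<close>, but
    the pair returns to \<open>P\<close> after each round, so ambiguity persists throughout.\<close>
  have w': "amb_word P w' P" unfolding w'_def by (rule amb_word_replicate[OF w ne])
  have "w' \<noteq> []" using p(2) \<open>w \<noteq> []\<close> by (cases k) (auto simp: w'_def)
  obtain t where t: "path S p t p" "word_label S t = w'"
    using p(3) unfolding lpath_def w'_def by blast
  have "t \<noteq> []" using t(2) \<open>w' \<noteq> []\<close> by auto
  have "p \<in> estimate S v" using p(1) v by blast
  then obtain x0 u where u: "x0 \<in> init S" "path S x0 u p" "word_label S u = v"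
    unfolding estimate_def by blast
  show ?thesis
  proof (rule not_detectableI[OF u(1,2) t(1) \<open>t \<noteq> []\<close>])
    fix s s' n assume "s @ s' = concat (replicate n t)"
    moreover have "word_label S (concat (replicate n t)) = concat (replicate n w')"
      using t(2) by (induction n) auto
    ultimately have "concat (replicate n w') = word_label S s @ word_label S s'"
      by (metis word_label_append)
    moreover have "amb_word P (concat (replicate n w')) P" by (rule amb_word_replicate[OF w' ne])
    ultimately obtain R where R: "lpath E P (word_label S s) R" "fst R \<noteq> snd R"
      unfolding amb_word_def by blast
    \<comment> \<open>Each component of \<open>R\<close> comes from \<open>x\<close> or
      \<open>y\<close>, and both lie in the estimate after \<open>v\<close>, whichever of them is
      \<open>p\<close>.\<close>
    have "z \<in> estimate S (v @ word_label S s)" if "z \<in> {fst R, snd R}" for z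
      using lpath_E_projection[OF R(1) that] v estimate_append[OF closed] unfolding xy by auto
    then show "\<exists>y\<in>estimate S (word_label S (u @ s)). \<exists>z\<in>estimate S (word_label S (u @ s)). y \<noteq> z"
      using R(2) u(3) by auto
  qed
qed

section \<open>Cycles as indexed sequences\<close>

text \<open>Supplies the membership in \<open>outputs S\<close> demanded by condition (ii), which
  \<open>amb_step\<close> leaves implicit.\<close>

lemma label_E_outputs:
  assumes "e \<in> events E" "label E e = Some a"
  shows "a \<in> outputs S"
proof (cases e)
  case None
  then show ?thesis using assms(2) label_E(1) by simp
next
  case (Some e')
  then show ?thesis
    using assms by (auto simp: label_E events_E self_comp_def cc_obs_events_def cc_unobs_events_def)
qed

lemma word_label_E_outputs:
  assumes "s \<in> lists (events E)"
  shows "word_label E s \<in> lists (outputs S)"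
  using assms
proof (induction s)
  case (Cons e s)
  then show ?case using label_E_outputs by (auto simp: word_label_Cons split: option.splits)
qed simp

text \<open>Relational powers are unfolded into sequences indexed from 0 to \<open>n\<close>, while
  condition (ii) counts from 1 to \<open>n + 1\<close>; both directions shift by one.\<close>

lemma cyclic_ambiguity_iff:
  "cyclic_ambiguity \<longleftrightarrow>
    (\<exists>(n::nat) (x :: nat \<Rightarrow> 'x) (x\<^sub>b :: nat \<Rightarrow> 'x) s. n > 0 \<and>
       (\<forall>i\<in>{1..n+1}. reachable E (x i, x\<^sub>b i)) \<and>
       (\<forall>i\<in>{1..n}. s i \<in> lists (events E) \<and> path E (x i, x\<^sub>b i) (s i) (x (i+1), x\<^sub>b (i+1))) \<and>
       (x 1, x\<^sub>b 1) = (x (n+1), x\<^sub>b (n+1)) \<and>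
       (\<forall>i\<in>{1..n}. x i \<noteq> x\<^sub>b i \<and> (\<exists>a\<in>outputs S. word_label E (s i) = [a])))"
  (is "_ \<longleftrightarrow> (\<exists>n x x\<^sub>b s. ?cycle n x x\<^sub>b s)")
proof
  assume cyclic_ambiguity
  then obtain P n where P: "n > 0" "reachable E P" "(P, P) \<in> amb_step ^^ n"
    unfolding cyclic_ambiguity_def by blast
  obtain f where f: "f 0 = P" "f n = P" "\<forall>i<n. (f i, f (Suc i)) \<in> amb_step"
    using P(3) unfolding relpow_fun_conv by blast
  have reach: "reachable E (f i)" if "i \<le> n" for i
  proof (rule reachable_amb_step[OF P(2)])
    show "(P, f i) \<in> amb_step ^^ i"
      unfolding relpow_fun_conv using f(1,3) that by (intro exI[of _ f]) auto
  qed
  have "\<forall>i\<in>{..<n}. \<exists>t. t \<in> lists (events E) \<and> path E (f i) t (f (Suc i)) \<and>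
      (\<exists>a\<in>outputs S. word_label E t = [a])"
  proof
    fix i assume "i \<in> {..<n}"
    then obtain a t where "t \<in> lists (events E)" "path E (f i) t (f (Suc i))" "word_label E t = [a]"
      using f(3) unfolding amb_step_def lpath_def by blast
    moreover from this have "a \<in> outputs S" using word_label_E_outputs[of t] by simp
    ultimately show "\<exists>t. t \<in> lists (events E) \<and> path E (f i) t (f (Suc i)) \<and>
      (\<exists>a\<in>outputs S. word_label E t = [a])" by blast
  qed
  from bchoice[OF this] obtain s where s: "\<forall>i\<in>{..<n}. s i \<in> lists (events E) \<and>
      path E (f i) (s i) (f (Suc i)) \<and> (\<exists>a\<in>outputs S. word_label E (s i) = [a])" by blast
  have ne: "fst (f i) \<noteq> snd (f i)" if "i < n" for i using f(3) that by (auto simp: amb_step_def)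
  show "\<exists>n x x\<^sub>b s. ?cycle n x x\<^sub>b s"
  proof (rule exI[of _ n], rule exI[of _ "\<lambda>i. fst (f (i - 1))"],
      rule exI[of _ "\<lambda>i. snd (f (i - 1))"], rule exI[of _ "\<lambda>i. s (i - 1)"], intro conjI ballI)
    fix i assume "i \<in> {1..n}"
    then obtain k where k: "i = Suc k" "k < n" by (cases i) auto
    show "s (i - 1) \<in> lists (events E)"
      "path E (fst (f (i - 1)), snd (f (i - 1))) (s (i - 1)) (fst (f (i + 1 - 1)), snd (f (i + 1 - 1)))"
      "fst (f (i - 1)) \<noteq> snd (f (i - 1))"
      "\<exists>a\<in>outputs S. word_label E (s (i - 1)) = [a]"
      using s ne k by auto
  qed (use P(1) f(1,2) reach in auto)
next
  assume "\<exists>n x x\<^sub>b s. ?cycle n x x\<^sub>b s"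
  then obtain n x x\<^sub>b s where c: "?cycle n x x\<^sub>b s" by (elim exE) (rule that)
  define f where "f i = (x (i + 1), x\<^sub>b (i + 1))" for i
  have fn: "f n = f 0" using c by (simp add: f_def)
  \<comment> \<open>Condition (ii) asserts distinctness only up to index \<open>n\<close>, that is
    for \<open>f 0\<close> to \<open>f (n - 1)\<close>; the last pair inherits it from
    \<open>f n = f 0\<close>.\<close>
  have ne: "fst (f i) \<noteq> snd (f i)" if "i \<le> n" for i
  proof -
    have "fst (f i) \<noteq> snd (f i)" if "i < n" for i using c that by (simp add: f_def)
    moreover have "0 < n" using c by blast
    ultimately show ?thesis using fn that by (cases "i = n") auto
  qed
  have "(f i, f (Suc i)) \<in> amb_step" if "i < n" for i
  proof -
    have i: "i + 1 \<in> {1..n}" using that by simp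
    then have "path E (f i) (s (i + 1)) (f (Suc i))" using c by (simp add: f_def)
    moreover obtain a where "word_label E (s (i + 1)) = [a]" using c i by blast
    ultimately have "lpath E (f i) [a] (f (Suc i))" using lpathI[OF closed_E] by metis
    then show ?thesis using ne[of i] ne[of "Suc i"] that by (auto simp: amb_step_def)
  qed
  then have "(f 0, f 0) \<in> amb_step ^^ n" unfolding relpow_fun_conv using fn by (intro exI[of _ f]) simp
  moreover have "reachable E (f 0)" using c by (simp add: f_def)
  ultimately show cyclic_ambiguity unfolding cyclic_ambiguity_def using c by blast
qed

theorem not_detectable_iff:
  "\<not> strongly_periodically_detectable S \<longleftrightarrow> silent_ambiguity \<or> cyclic_ambiguity"
  using ambiguity_if_not_detectable not_detectable_if_silent_ambiguity
    not_detectable_if_cyclic_ambiguity by blast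

end

theorem theorem4p11:
  fixes S :: "('x, 't, 'o) fsa"
  assumes "is_fsa S"
  shows "\<not> strongly_periodically_detectable S \<longleftrightarrow>
    (\<exists>x x\<^sub>b. reachable (eps_self_comp S) (x, x\<^sub>b) \<and> x \<noteq> x\<^sub>b \<and>
       (\<exists>s\<^sub>1 s\<^sub>2 x'. s\<^sub>1 \<in> lists (unobs_events S) \<and>
          s\<^sub>2 \<in> lists (unobs_events S) \<and> s\<^sub>2 \<noteq> [] \<and> x' \<in> states S \<and>
          path S x s\<^sub>1 x' \<and> path S x' s\<^sub>2 x'))
    \<or>
    (\<exists>(n::nat) (x :: nat \<Rightarrow> 'x) (x\<^sub>b :: nat \<Rightarrow> 'x) s. n > 0 \<and>
       (\<forall>i\<in>{1..n+1}. reachable (eps_self_comp S) (x i, x\<^sub>b i)) \<and>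
       (\<forall>i\<in>{1..n}. s i \<in> lists (events (eps_self_comp S)) \<and>
          path (eps_self_comp S) (x i, x\<^sub>b i) (s i) (x (i+1), x\<^sub>b (i+1))) \<and>
       (x 1, x\<^sub>b 1) = (x (n+1), x\<^sub>b (n+1)) \<and>
       (\<forall>i\<in>{1..n}. x i \<noteq> x\<^sub>b i \<and>
          (\<exists>a\<in>outputs S. word_label (eps_self_comp S) (s i) = [a])))"
proof -
  interpret finite_fsa S using assms by unfold_locales
  show ?thesis
    using not_detectable_iff
    unfolding cyclic_ambiguity_iff silent_ambiguity_def silently_divergent_def .
qed

end
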